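(* For every $\mu>1$, the domain $\Omega_\mu$ is not hyperconvex.
   Context: Let $\tilde M=\mathbb{C}\times(\mathbb{C}\setminus\{0\})$. For $\mu>0$, $M_\mu$ is the complex manifold obtained as the quotient of $\tilde M$ by the equivalence relation generated by $(z_1,z_2)\sim(e^{2\pi\mu i}z_1,e^{\pi\mu}z_2)$. Let $\tilde\Omega=\{z\in\tilde M:|z_1+e^{i\log|z_2|^2}|^2<1\}$ and, for $\mu>1$, $\Omega_\mu=\{[z]\in M_\mu:z\in\tilde\Omega\}$. A domain $\Omega$ is hyperconvex if it admits a bounded plurisubharmonic exhaustion function, i.e. a bounded plurisubharmonic function $f:\Omega\to(-\infty,0)$ such that $\{f<c\}$ is relatively compact in $\Omega$ for every $c<0$. *)

theory Defs
  imports "HOL-Analysis.Analysis"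
begin

section \<open>Plurisubharmonic functions and hyperconvexity\<close>

text \<open>Only finite-valued functions are considered. The mean value inequality is imposed on the
  closed discs \<open>a + \<zeta> b\<close>, \<open>\<bar>\<zeta>\<bar> \<le> 1\<close>, contained in \<open>D\<close>; as \<open>b\<close> is arbitrary, this covers all radii.
  Integrability over the circle is demanded explicitly because the library integral of a
  non-integrable function is 0; for finite-valued \<open>u\<close> it is a consequence of the inequality
  when the mean is read as an extended real number.\<close>

definition psh_on :: "(complex \<times> complex) set \<Rightarrow> (complex \<times> complex \<Rightarrow> real) \<Rightarrow> bool" where
  "psh_on D u \<longleftrightarrow>
     (\<forall>c. openin (top_of_set D) {x \<in> D. u x < c}) \<and>
     (\<forall>a1 a2 b1 b2. (\<forall>\<zeta>. cmod \<zeta> \<le> 1 \<longrightarrow> (a1 + \<zeta> * b1, a2 + \<zeta> * b2) \<in> D) \<longrightarrow>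
        (\<lambda>t. u (a1 + cis t * b1, a2 + cis t * b2)) absolutely_integrable_on {0..2*pi} \<and>
        u (a1, a2) \<le> 1 / (2*pi) * integral {0..2*pi} (\<lambda>t. u (a1 + cis t * b1, a2 + cis t * b2)))"

text \<open>A complex surface is given by its topology \<open>X\<close> and a holomorphic atlas \<open>A\<close>, a set of pairs
  \<open>(U, \<phi>)\<close> with \<open>\<phi>\<close> injective from the open set \<open>U\<close> onto an open subset of \<open>\<complex>\<^sup>2\<close>. Since
  plurisubharmonicity is local and invariant under holomorphic coordinate changes, it suffices
  to test it in the charts of one atlas.\<close>

definition psh_on_surface ::
    "('a set \<times> ('a \<Rightarrow> complex \<times> complex)) set \<Rightarrow> 'a set \<Rightarrow> ('a \<Rightarrow> real) \<Rightarrow> bool" where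
  "psh_on_surface A \<Omega> f \<longleftrightarrow>
     (\<forall>(U, \<phi>) \<in> A. psh_on (\<phi> ` (U \<inter> \<Omega>)) (f \<circ> inv_into U \<phi>))"

definition relatively_compactin :: "'a topology \<Rightarrow> 'a set \<Rightarrow> bool" where
  "relatively_compactin X S \<longleftrightarrow> S \<subseteq> topspace X \<and> compactin X (X closure_of S)"

definition hyperconvex ::
    "'a topology \<Rightarrow> ('a set \<times> ('a \<Rightarrow> complex \<times> complex)) set \<Rightarrow> 'a set \<Rightarrow> bool" where
  "hyperconvex X A \<Omega> \<longleftrightarrow>
     (\<exists>f. (\<forall>p\<in>\<Omega>. f p < 0) \<and> bounded (f ` \<Omega>) \<and> psh_on_surface A \<Omega> f \<and>
          (\<forall>c<0. relatively_compactin (subtopology X \<Omega>) {p \<in> \<Omega>. f p < c}))"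


section \<open>The surfaces \<open>M\<^sub>\<mu>\<close> and the domains \<open>\<Omega>\<^sub>\<mu>\<close>\<close>

definition M_cover :: "(complex \<times> complex) set" where
  "M_cover = UNIV \<times> (UNIV - {0})"

definition deck :: "real \<Rightarrow> complex \<times> complex \<Rightarrow> complex \<times> complex" where
  "deck \<mu> = (\<lambda>(z1, z2). (exp (complex_of_real (2 * pi * \<mu>) * \<i>) * z1, complex_of_real (exp (pi * \<mu>)) * z2))"

definition M_rel :: "real \<Rightarrow> ((complex \<times> complex) \<times> (complex \<times> complex)) set" where
  "M_rel \<mu> = {(z, w) \<in> M_cover \<times> M_cover. equivclp (\<lambda>x y. x \<in> M_cover \<and> y = deck \<mu> x) z w}"

definition M_space :: "real \<Rightarrow> (complex \<times> complex) set set" where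
  "M_space \<mu> = M_cover // M_rel \<mu>"

definition M_proj :: "real \<Rightarrow> complex \<times> complex \<Rightarrow> (complex \<times> complex) set" where
  "M_proj \<mu> z = M_rel \<mu> `` {z}"

definition M_top :: "real \<Rightarrow> (complex \<times> complex) set topology" where
  "M_top \<mu> = topology (\<lambda>U. U \<subseteq> M_space \<mu> \<and> openin (top_of_set M_cover) {z \<in> M_cover. M_proj \<mu> z \<in> U})"

text \<open>The quotient complex structure: the charts are the local inverses of the projection.\<close>

definition M_atlas ::
    "real \<Rightarrow> ((complex \<times> complex) set set \<times> ((complex \<times> complex) set \<Rightarrow> complex \<times> complex)) set" where
  "M_atlas \<mu> = {(M_proj \<mu> ` V, inv_into V (M_proj \<mu>)) | V.
                  open V \<and> V \<subseteq> M_cover \<and> inj_on (M_proj \<mu>) V}"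

definition Omega_cover :: "(complex \<times> complex) set" where
  "Omega_cover = {(z1, z2) \<in> M_cover. (cmod (z1 + exp (\<i> * complex_of_real (ln ((cmod z2)\<^sup>2)))))\<^sup>2 < 1}"

definition Omega :: "real \<Rightarrow> (complex \<times> complex) set set" where
  "Omega \<mu> = M_proj \<mu> ` Omega_cover"


subsection \<open>Basic properties\<close>

lemma open_M_cover: "open M_cover"
  unfolding M_cover_def by (intro open_Times) auto

lemma equiv_M_rel: "equiv M_cover (M_rel \<mu>)"
proof (rule equivI)
  show "M_rel \<mu> \<subseteq> M_cover \<times> M_cover" by (auto simp: M_rel_def)
  show "refl_on M_cover (M_rel \<mu>)" by (auto simp: M_rel_def refl_on_def)
  show "sym (M_rel \<mu>)" by (auto simp: M_rel_def sym_def intro: equivclp_sym)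
  show "trans (M_rel \<mu>)" by (auto simp: M_rel_def trans_def intro: equivclp_trans)
qed

lemma M_proj_eq_iff:
  assumes "z \<in> M_cover" "w \<in> M_cover"
  shows "M_proj \<mu> z = M_proj \<mu> w \<longleftrightarrow> equivclp (\<lambda>x y. x \<in> M_cover \<and> y = deck \<mu> x) z w"
  using eq_equiv_class_iff[OF equiv_M_rel assms] assms unfolding M_proj_def by (auto simp: M_rel_def)

lemma openin_M_top:
  "openin (M_top \<mu>) U \<longleftrightarrow> U \<subseteq> M_space \<mu> \<and> openin (top_of_set M_cover) {z \<in> M_cover. M_proj \<mu> z \<in> U}"
proof -
  have "istopology (\<lambda>U. U \<subseteq> M_space \<mu> \<and> openin (top_of_set M_cover) {z \<in> M_cover. M_proj \<mu> z \<in> U})"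
    unfolding istopology_def
  proof (intro conjI allI impI)
    fix S T
    assume S: "S \<subseteq> M_space \<mu> \<and> openin (top_of_set M_cover) {z \<in> M_cover. M_proj \<mu> z \<in> S}"
      and T: "T \<subseteq> M_space \<mu> \<and> openin (top_of_set M_cover) {z \<in> M_cover. M_proj \<mu> z \<in> T}"
    show "S \<inter> T \<subseteq> M_space \<mu>" using S by auto
    have "{z \<in> M_cover. M_proj \<mu> z \<in> S \<inter> T} =
        {z \<in> M_cover. M_proj \<mu> z \<in> S} \<inter> {z \<in> M_cover. M_proj \<mu> z \<in> T}" by auto
    then show "openin (top_of_set M_cover) {z \<in> M_cover. M_proj \<mu> z \<in> S \<inter> T}"
      using S T by (simp add: openin_Int)
  next
    fix \<K>
    assume K: "\<forall>K\<in>\<K>. K \<subseteq> M_space \<mu> \<and> openin (top_of_set M_cover) {z \<in> M_cover. M_proj \<mu> z \<in> K}"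
    show "\<Union>\<K> \<subseteq> M_space \<mu>" using K by auto
    have "{z \<in> M_cover. M_proj \<mu> z \<in> \<Union>\<K>} = (\<Union>K\<in>\<K>. {z \<in> M_cover. M_proj \<mu> z \<in> K})" by auto
    then show "openin (top_of_set M_cover) {z \<in> M_cover. M_proj \<mu> z \<in> \<Union>\<K>}"
      using K by (metis (no_types, lifting) openin_Union image_iff)
  qed
  then show ?thesis by (simp add: M_top_def topology_inverse')
qed

lemma topspace_M_top: "topspace (M_top \<mu>) = M_space \<mu>"
proof -
  have "{z \<in> M_cover. M_proj \<mu> z \<in> M_space \<mu>} = M_cover"
    by (auto simp: M_space_def M_proj_def quotientI)
  then have "openin (M_top \<mu>) (M_space \<mu>)"
    by (simp add: openin_M_top)
  then show ?thesis
    by (meson openin_M_top openin_subset openin_topspace subset_antisym)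
qed

lemma quotient_map_M_proj: "quotient_map (top_of_set M_cover) (M_top \<mu>) (M_proj \<mu>)"
  unfolding quotient_map_def topspace_M_top openin_M_top
  by (auto simp: M_space_def M_proj_def quotient_def)

lemma deck_orbit:
  assumes "equivclp (\<lambda>x y. x \<in> M_cover \<and> y = deck \<mu> x) z w" "z \<in> M_cover"
  shows "\<exists>n::int. w = (exp (complex_of_real (n * (2 * pi * \<mu>)) * \<i>) * fst z,
                       complex_of_real (exp (n * (pi * \<mu>))) * snd z)"
  using assms
proof (induction rule: equivclp_induct)
  case base
  show ?case by (intro exI[of _ 0]) simp
next
  case (step x y)
  define E where "E = (\<lambda>n::int. exp (complex_of_real (n * (2 * pi * \<mu>)) * \<i>))"
  define F where "F = (\<lambda>n::int. complex_of_real (exp (n * (pi * \<mu>))))"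
  have E: "E (m + n) = E m * E n" and F: "F (m + n) = F m * F n" for m n
    by (simp_all add: E_def F_def distrib_right exp_add)
  have deck: "deck \<mu> p = (E 1 * fst p, F 1 * snd p)" for p
    by (simp add: deck_def E_def F_def case_prod_beta)
  have inv: "E (-1) * E 1 = 1" "F (-1) * F 1 = 1"
    using E[of "-1" 1] F[of "-1" 1] by (simp_all add: E_def F_def)
  obtain n where n: "x = (E n * fst z, F n * snd z)"
    using step by (auto simp: E_def F_def)
  from step.hyps(2) have "\<exists>n. y = (E n * fst z, F n * snd z)"
  proof
    assume "x \<in> M_cover \<and> y = deck \<mu> x"
    then have "y = (E (1 + n) * fst z, F (1 + n) * snd z)"
      using n by (simp add: deck E F mult.assoc)
    then show ?thesis by blast
  next
    assume "y \<in> M_cover \<and> x = deck \<mu> y"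
    then have x: "fst x = E 1 * fst y" "snd x = F 1 * snd y" by (simp_all add: deck)
    have "fst y = E (-1) * fst x" "snd y = F (-1) * snd x"
      unfolding x mult.assoc[symmetric] inv by simp_all
    then have "y = (E (-1 + n) * fst z, F (-1 + n) * snd z)"
      unfolding E F using n by (simp add: prod_eq_iff mult.assoc)
    then show ?thesis by blast
  qed
  then show ?case by (simp add: E_def F_def)
qed

lemma Omega_cover_deck:
  assumes "z \<in> M_cover"
  shows "deck \<mu> z \<in> Omega_cover \<longleftrightarrow> z \<in> Omega_cover"
proof -
  obtain z1 z2 where z: "z = (z1, z2)" by (cases z)
  have z2: "z2 \<noteq> 0" using assms z by (auto simp: M_cover_def)
  have "ln ((cmod (complex_of_real (exp (pi * \<mu>)) * z2))\<^sup>2) = 2 * pi * \<mu> + ln ((cmod z2)\<^sup>2)"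
    using z2 by (simp add: norm_mult ln_mult power_mult_distrib ln_realpow)
  then have "exp (\<i> * complex_of_real (ln ((cmod (complex_of_real (exp (pi * \<mu>)) * z2))\<^sup>2))) =
      exp (complex_of_real (2 * pi * \<mu>) * \<i>) * exp (\<i> * complex_of_real (ln ((cmod z2)\<^sup>2)))"
    by (simp add: exp_add[symmetric] algebra_simps mult_exp_exp)
  then have "exp (complex_of_real (2 * pi * \<mu>) * \<i>) * z1 + exp (\<i> * complex_of_real (ln ((cmod (complex_of_real (exp (pi * \<mu>)) * z2))\<^sup>2))) =
      exp (complex_of_real (2 * pi * \<mu>) * \<i>) * (z1 + exp (\<i> * complex_of_real (ln ((cmod z2)\<^sup>2))))"
    by (simp only: distrib_left)
  then have "cmod (exp (complex_of_real (2 * pi * \<mu>) * \<i>) * z1 + exp (\<i> * complex_of_real (ln ((cmod (complex_of_real (exp (pi * \<mu>)) * z2))\<^sup>2)))) =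
      cmod (z1 + exp (\<i> * complex_of_real (ln ((cmod z2)\<^sup>2))))"
    by (simp only: norm_mult) (simp add: norm_exp_eq_Re)
  then show ?thesis
    using z z2 by (simp add: deck_def Omega_cover_def M_cover_def)
qed

lemma M_proj_in_Omega_iff:
  assumes "z \<in> M_cover"
  shows "M_proj \<mu> z \<in> Omega \<mu> \<longleftrightarrow> z \<in> Omega_cover"
proof
  assume "M_proj \<mu> z \<in> Omega \<mu>"
  then obtain w where w: "w \<in> Omega_cover" "M_proj \<mu> z = M_proj \<mu> w" by (auto simp: Omega_def)
  then have "w \<in> M_cover" by (auto simp: Omega_cover_def)
  then have "equivclp (\<lambda>x y. x \<in> M_cover \<and> y = deck \<mu> x) w z"
    using M_proj_eq_iff[of w z \<mu>] assms w(2) by simp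
  then show "z \<in> Omega_cover"
    by (induction rule: equivclp_induct) (use w Omega_cover_deck in blast)+
qed (auto simp: Omega_def)

lemma continuous_on_twist:
  "continuous_on M_cover (\<lambda>z. exp (\<i> * complex_of_real (ln ((cmod (snd z))\<^sup>2))))"
  unfolding M_cover_def by (intro continuous_intros) auto

lemma open_Omega_cover: "open Omega_cover"
proof -
  let ?h = "\<lambda>z. (cmod (fst z + exp (\<i> * complex_of_real (ln ((cmod (snd z))\<^sup>2)))))\<^sup>2"
  have "continuous_on M_cover ?h"
    by (intro continuous_on_power continuous_on_norm continuous_on_add continuous_on_fst
        continuous_on_id continuous_on_twist)
  then have "open (M_cover \<inter> ?h -` {..<1})"
    using open_M_cover open_lessThan by (rule continuous_open_preimage)
  also have "M_cover \<inter> ?h -` {..<1} = Omega_cover"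
    by (auto simp: Omega_cover_def)
  finally show ?thesis .
qed

lemma connected_Omega_cover: "connected Omega_cover"
proof -
  let ?e = "\<lambda>z2. exp (\<i> * complex_of_real (ln ((cmod z2)\<^sup>2)))"
  let ?g = "\<lambda>z. (fst z - ?e (snd z), snd z)"
  have eq: "Omega_cover = ?g ` (ball 0 1 \<times> (- {0}))"
  proof (intro equalityI subsetI)
    fix z assume z: "z \<in> Omega_cover"
    then have "z = ?g (fst z + ?e (snd z), snd z)" by simp
    moreover have "(fst z + ?e (snd z), snd z) \<in> ball 0 1 \<times> (- {0})"
      using z by (auto simp: Omega_cover_def M_cover_def abs_square_less_1)
    ultimately show "z \<in> ?g ` (ball 0 1 \<times> (- {0}))" by blast
  qed (auto simp: Omega_cover_def M_cover_def abs_square_less_1)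
  have "connected (- {0::complex})"
    using connected_punctured_universe[of "0::complex"] by simp
  then have "connected (ball (0::complex) 1 \<times> (- {0::complex}))"
    by (intro connected_Times) auto
  moreover have "continuous_on (ball 0 1 \<times> (- {0})) ?g"
    by (intro continuous_intros) auto
  ultimately show ?thesis unfolding eq by (rule connected_continuous_image[rotated])
qed

lemma Omega_domain: "openin (M_top \<mu>) (Omega \<mu>)" "connectedin (M_top \<mu>) (Omega \<mu>)" "Omega \<mu> \<noteq> {}"
proof -
  have sub: "Omega_cover \<subseteq> M_cover" by (auto simp: Omega_cover_def)
  have "{z \<in> M_cover. M_proj \<mu> z \<in> Omega \<mu>} = Omega_cover"
    using sub M_proj_in_Omega_iff by auto
  then show "openin (M_top \<mu>) (Omega \<mu>)"
    using sub open_Omega_cover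
    by (auto simp: openin_M_top Omega_def M_space_def M_proj_def quotientI intro!: open_subset)
  show "connectedin (M_top \<mu>) (Omega \<mu>)"
    unfolding Omega_def
    by (rule connectedin_continuous_map_image[OF quotient_imp_continuous_map[OF quotient_map_M_proj]])
       (use sub connected_Omega_cover in \<open>auto simp: connectedin_subtopology\<close>)
  have "(-1, 1) \<in> Omega_cover" by (simp add: Omega_cover_def M_cover_def)
  then show "Omega \<mu> \<noteq> {}" by (auto simp: Omega_def)
qed

lemma M_atlas_covers:
  assumes "\<mu> > 0" "p \<in> M_space \<mu>"
  obtains U \<phi> where "(U, \<phi>) \<in> M_atlas \<mu>" "p \<in> U"
proof -
  from assms(2) obtain z where z: "z \<in> M_cover" "p = M_proj \<mu> z"
    by (auto simp: M_space_def M_proj_def quotient_def)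
  let ?V = "{w \<in> M_cover. ln (cmod (snd w)) \<in> ball (ln (cmod (snd z))) (pi * \<mu> / 2)}"
  have "continuous_on M_cover (\<lambda>w. ln (cmod (snd w)))"
    by (intro continuous_on_ln continuous_on_norm continuous_on_snd continuous_on_id) (auto simp: M_cover_def)
  then have "open (M_cover \<inter> (\<lambda>w. ln (cmod (snd w))) -` ball (ln (cmod (snd z))) (pi * \<mu> / 2))"
    using open_M_cover open_ball by (rule continuous_open_preimage)
  also have "M_cover \<inter> (\<lambda>w. ln (cmod (snd w))) -` ball (ln (cmod (snd z))) (pi * \<mu> / 2) = ?V"
    by blast
  finally have "open ?V" .
  moreover have "inj_on (M_proj \<mu>) ?V"
  proof (rule inj_onI)
    fix x y assume x: "x \<in> ?V" and y: "y \<in> ?V" and "M_proj \<mu> x = M_proj \<mu> y"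
    then have "equivclp (\<lambda>x y. x \<in> M_cover \<and> y = deck \<mu> x) x y" using M_proj_eq_iff by blast
    then obtain n :: int where n: "y = (exp (complex_of_real (n * (2 * pi * \<mu>)) * \<i>) * fst x, complex_of_real (exp (n * (pi * \<mu>))) * snd x)"
      using deck_orbit[of \<mu> x y] x by auto
    have "snd x \<noteq> 0" using x by (auto simp: M_cover_def)
    have "cmod (snd y) = exp (n * (pi * \<mu>)) * cmod (snd x)"
      using n by (simp add: norm_mult norm_exp_eq_Re)
    then have "ln (cmod (snd y)) = n * (pi * \<mu>) + ln (cmod (snd x))"
      using \<open>snd x \<noteq> 0\<close> by (simp add: ln_mult)
    moreover have "\<bar>ln (cmod (snd y)) - ln (cmod (snd x))\<bar> < pi * \<mu>"
      using x y by (simp add: dist_real_def abs_if split: if_splits)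
    ultimately have "\<bar>real_of_int n\<bar> * (pi * \<mu>) < 1 * (pi * \<mu>)"
      using assms(1) by (simp add: abs_mult)
    then have "\<bar>real_of_int n\<bar> < 1"
      using assms(1) by (meson mult_less_cancel_right_disj mult_pos_pos pi_gt_zero less_asym)
    then have "n = 0" by linarith
    then show "x = y" using n by simp
  qed
  ultimately have "(M_proj \<mu> ` ?V, inv_into ?V (M_proj \<mu>)) \<in> M_atlas \<mu>"
    unfolding M_atlas_def by blast
  moreover have "p \<in> M_proj \<mu> ` ?V" using z assms(1) by auto
  ultimately show thesis using that by blast
qed

end

theory Submission
  imports Defs "HOL-Complex_Analysis.Complex_Analysis"
begin

text \<open>
  The obstruction is a punctured disc in \<open>\<Omega>\<^sub>\<mu>\<close> whose puncture lies on the boundary torus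
  \<open>{z\<^sub>1 = 0}\<close>. The curve \<open>w \<mapsto> (- exp w, exp (- \<i> w / 2))\<close> satisfies
  \<open>log \<bar>z\<^sub>2\<bar>\<^sup>2 = Im w = arg (- z\<^sub>1)\<close>, hence \<open>\<bar>z\<^sub>1 + exp (\<i> log \<bar>z\<^sub>2\<bar>\<^sup>2)\<bar> = \<bar>1 - \<bar>z\<^sub>1\<bar>\<bar>\<close>, and it
  stays in \<open>\<Omega>\<close> as long as \<open>0 < \<bar>z\<^sub>1\<bar> < 2\<close>. The deck transformation carries
  the point of parameter \<open>w\<close> to the point of parameter \<open>w + 2 \<pi> \<mu> \<i>\<close>. In the quotient the curve
  is therefore a punctured disc, with \<open>z\<^sub>1 \<rightarrow> 0\<close> at the puncture. A negative psh exhaustion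
  would restrict to a negative subharmonic function on it that tends to \<open>0\<close> at the puncture; as
  bounded subharmonic functions extend over punctures, this violates the maximum principle.

  Plurisubharmonicity is a condition on affine discs, and the curve is not affine; a
  psh function that is merely upper semicontinuous can be restricted to it only after a
  regularisation. The proof avoids the restriction by applying the maximum principle on a
  two-dimensional tube around the curve, to \<open>u + \<eta> log (2 \<bar>z\<^sub>1\<bar>) + 4 m \<bar>z\<^sub>1\<bar>\<^sup>2 - 4 m (1 - cos a)\<close>, where
  \<open>a = arg (- z\<^sub>1) - log \<bar>z\<^sub>2\<bar>\<^sup>2\<close> is \<open>0\<close> on the curve and constant on its translates, the leaves.
  The logarithm takes care of the puncture, the last term pushes the values down on the sides
  of the tube, and the middle term makes the sum strictly subharmonic along a leaf.
  On an affine disc of size \<open>\<rho>\<close> tangent to a leaf, the angle \<open>a\<close> is harmonic and moves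
  only by \<open>O(\<rho>\<^sup>2)\<close>, so the last term costs only \<open>O(\<rho>\<^sup>4)\<close> in the mean, less than the gain
  of order \<open>\<rho>\<^sup>2\<close> from \<open>\<bar>z\<^sub>1\<bar>\<^sup>2\<close>. This excludes an interior maximum
  (\<open>no_local_max_with_barrier\<close>). Letting \<open>\<eta> \<rightarrow> 0\<close> gives \<open>u \<le> - m < 0\<close> on the curve up to the
  puncture (\<open>negative_psh_bounded_away_from_0\<close>). A relatively compact sublevel set would then
  contain points of \<open>\<Omega>\<^sub>\<mu>\<close> with \<open>\<bar>z\<^sub>1\<bar>\<close> arbitrarily small, although the
  continuous function \<open>\<bar>z\<^sub>1\<bar>\<close> does not vanish on \<open>\<Omega>\<^sub>\<mu>\<close>.
\<close>

section \<open>Semicontinuous maxima and circle means\<close>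

text \<open>If no maximum were attained, the interiors of the sets \<open>{g < g y}\<close> with \<open>y \<in> K\<close> would cover \<open>K\<close>;
  the largest of the finitely many values \<open>g y\<close> of a subcover contradicts this.\<close>

lemma upper_semicontinuous_attains_max:
  fixes g :: "'a::topological_space \<Rightarrow> real"
  assumes "compact K" "K \<noteq> {}"
    and usc: "\<And>x c. x \<in> K \<Longrightarrow> g x < c \<Longrightarrow> eventually (\<lambda>y. g y < c) (nhds x)"
  shows "\<exists>x\<in>K. \<forall>y\<in>K. g y \<le> g x"
proof (rule ccontr)
  assume no_max: "\<not> ?thesis"
  define S where "S y = interior {x. g x < g y}" for y
  have "K \<subseteq> (\<Union>y\<in>K. S y)"
  proof
    fix x assume "x \<in> K"
    then obtain y where "y \<in> K" "g x < g y" using no_max by (auto simp: not_le)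
    then have "x \<in> S y"
      using usc[OF \<open>x \<in> K\<close>, of "g y"] by (auto simp: S_def eventually_nhds interior_def)
    then show "x \<in> (\<Union>y\<in>K. S y)" using \<open>y \<in> K\<close> by blast
  qed
  then obtain T where T: "T \<subseteq> K" "finite T" "K \<subseteq> (\<Union>y\<in>T. S y)"
    using compactE_image[OF \<open>compact K\<close>, of K S] by (auto simp: S_def)
  then have "T \<noteq> {}" using \<open>K \<noteq> {}\<close> by auto
  define M where "M = Max (g ` T)"
  have "M \<in> g ` T" using T \<open>T \<noteq> {}\<close> by (simp add: M_def)
  then obtain x where x: "x \<in> T" "g x = M" by auto
  obtain y where y: "y \<in> T" "x \<in> S y" using x T by blast
  then have "g x < g y" using interior_subset by (auto simp: S_def)
  moreover have "g y \<le> M" using y T by (simp add: M_def)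
  ultimately show False using x by simp
qed

lemma holomorphic_circle_mean:
  fixes f :: "complex \<Rightarrow> complex"
  assumes f: "f holomorphic_on cball 0 r" and r: "r > 0"
  shows "((\<lambda>t. f (r * cis t)) has_integral (2 * pi * f 0)) {0..2*pi}"
proof -
  have "((\<lambda>u. f u / (u - 0)) has_contour_integral (2 * of_real pi * \<i> * f 0)) (circlepath 0 r)"
    using f r by (intro Cauchy_integral_circlepath_simple) auto
  then have "((\<lambda>t. f (0 + r * cis t) / (0 + r * cis t - 0) * r * \<i> * cis t)
      has_integral (2 * of_real pi * \<i> * f 0)) {0..2*pi}"
    unfolding circlepath_def by (subst (asm) has_contour_integral_part_circlepath_iff) auto
  then have "((\<lambda>t. \<i> * f (r * cis t)) has_integral (2 * of_real pi * \<i> * f 0)) {0..2*pi}"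
    using r by (simp add: field_simps)
  from has_integral_mult_right[OF this, of "-\<i>"] show ?thesis
    by (simp add: mult_ac)
qed

lemma Ln_circle_mean:
  assumes "0 < r" "cmod c * r < 1"
  shows "((\<lambda>t. Ln (1 + c * (r * cis t))) has_integral 0) {0..2*pi}"
proof -
  have "1 + c * w \<notin> \<real>\<^sub>\<le>\<^sub>0" if "w \<in> cball 0 r" for w
  proof -
    have "cmod (c * w) \<le> cmod c * r"
      using that by (auto simp: norm_mult intro: mult_left_mono)
    then have "\<bar>Re (c * w)\<bar> < 1" using assms abs_Re_le_cmod[of "c * w"] by linarith
    then show ?thesis by (auto simp: complex_nonpos_Reals_iff)
  qed
  then have "(\<lambda>w. Ln (1 + c * w)) holomorphic_on cball 0 r"
    by (intro holomorphic_intros) auto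
  from holomorphic_circle_mean[OF this] show ?thesis using assms by simp
qed

section \<open>The barrier\<close>

text \<open>This is \<open>exp (\<i> a)\<close> for the angle \<open>a = arg (- z\<^sub>1) - log \<bar>z\<^sub>2\<bar>\<^sup>2\<close>. The angle itself
  is defined only modulo \<open>2 \<pi>\<close>, whereas its exponential is continuous and invariant under
  the deck transformation.\<close>

definition phase :: "complex \<times> complex \<Rightarrow> complex" where
  "phase z = - sgn (fst z) * cis (- ln ((cmod (snd z))\<^sup>2))"

definition barrier :: "real \<Rightarrow> real \<Rightarrow> complex \<times> complex \<Rightarrow> real" where
  "barrier \<eta> m z = \<eta> * ln (2 * cmod (fst z)) + 4 * m * (cmod (fst z))\<^sup>2 - 4 * m * (1 - Re (phase z))"

lemma norm_phase: "fst z \<noteq> 0 \<Longrightarrow> cmod (phase z) = 1"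
  by (simp add: phase_def norm_mult norm_sgn)

lemma Omega_cover_iff_phase:
  assumes "snd z \<noteq> 0"
  shows "z \<in> Omega_cover \<longleftrightarrow> fst z \<noteq> 0 \<and> cmod (fst z) < 2 * Re (phase z)"
proof -
  define t where "t = ln ((cmod (snd z))\<^sup>2)"
  have "z \<in> Omega_cover \<longleftrightarrow>
      (cmod (fst z + exp (\<i> * complex_of_real (ln ((cmod (snd z))\<^sup>2)))))\<^sup>2 < 1"
    using assms unfolding Omega_cover_def M_cover_def by (auto simp: case_prod_beta mem_Times_iff)
  also have "exp (\<i> * complex_of_real (ln ((cmod (snd z))\<^sup>2))) = cis t"
    unfolding t_def cis_conv_exp ..
  also have "(cmod (fst z + cis t))\<^sup>2 < 1 \<longleftrightarrow> fst z \<noteq> 0 \<and> cmod (fst z) < 2 * Re (phase z)"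
  proof (cases "fst z = 0")
    case False
    define r where "r = cmod (fst z)"
    have r: "r > 0" using False by (simp add: r_def)
    have "r * Re (phase z) = - Re (fst z * cis (- t))"
      using r by (simp add: phase_def t_def[symmetric] sgn_eq r_def[symmetric] field_simps)
    moreover have "(cmod (fst z + cis t))\<^sup>2 = r\<^sup>2 + 2 * Re (fst z * cis (- t)) + 1"
      by (simp add: cmod_power2 r_def power2_sum algebra_simps)
    ultimately have "(cmod (fst z + cis t))\<^sup>2 < 1 \<longleftrightarrow> r * r < r * (2 * Re (phase z))"
      by (simp add: power2_eq_square mult.left_commute) linarith
    then show ?thesis using False r by (simp add: r_def)
  qed simp
  finally show ?thesis .
qed

lemma continuous_on_phase: "continuous_on ((- {0}) \<times> (- {0})) phase"
  unfolding phase_def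
  by (intro continuous_intros) auto

lemma continuous_on_barrier: "continuous_on ((- {0}) \<times> (- {0})) (barrier \<eta> m)"
  unfolding barrier_def
  by (intro continuous_intros continuous_on_phase) auto

text \<open>In logarithmic coordinates the angle is a real linear function, so the principal
  logarithms of the factors give the exact change of the angle.\<close>

lemma phase_multiply:
  assumes z: "fst z \<noteq> 0" "snd z \<noteq> 0" and ab: "a \<noteq> 0" "b \<noteq> 0"
  shows "phase (fst z * a, snd z * b) = phase z * cis (Im (Ln a) - 2 * Re (Ln b))"
proof -
  have "sgn a = cis (Im (Ln a))"
  proof -
    have "a = exp (Ln a)" using ab by simp
    then have "a = of_real (exp (Re (Ln a))) * cis (Im (Ln a))"
      by (simp add: exp_eq_polar)
    moreover have "exp (Re (Ln a)) = cmod a" using ab by simp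
    ultimately have "a = of_real (cmod a) * cis (Im (Ln a))" by metis
    then have "a / of_real (cmod a) = cis (Im (Ln a))"
      using ab by (metis mult.commute nonzero_mult_div_cancel_right norm_eq_zero of_real_eq_0_iff)
    then show ?thesis by (simp add: sgn_eq)
  qed
  moreover have "ln ((cmod (snd z * b))\<^sup>2) = ln ((cmod (snd z))\<^sup>2) + 2 * Re (Ln b)"
    using z ab by (simp add: norm_mult power_mult_distrib ln_mult ln_realpow)
  ultimately show ?thesis
    by (simp add: phase_def sgn_mult cis_mult algebra_simps)
qed

text \<open>A first-order expansion of \<open>cos (a + x)\<close> at \<open>x = 0\<close>. The linear term is kept apart because it
  has mean \<open>0\<close> when \<open>x\<close> runs over the values of a harmonic function that vanishes at the centre.\<close>

lemma Re_mult_cis_ge: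
  assumes "cmod A = 1"
  shows "Re (A * cis x) \<ge> Re A - x * Im A - x\<^sup>2"
proof -
  have "cmod (exp (\<i> * x) - (\<Sum>k\<le>1. (\<i> * x) ^ k / fact k)) \<le>
      exp \<bar>Re (\<i> * x)\<bar> * cmod (\<i> * x) ^ Suc 1 / fact 1"
    by (rule Taylor_exp)
  then have "cmod (cis x - (1 + \<i> * x)) \<le> x\<^sup>2"
    by (simp add: cis_conv_exp norm_mult power2_eq_square)
  then have "cmod (A * (cis x - (1 + \<i> * x))) \<le> x\<^sup>2"
    using assms by (simp add: norm_mult)
  then have "\<bar>Re (A * (cis x - (1 + \<i> * x)))\<bar> \<le> x\<^sup>2"
    using abs_Re_le_cmod order_trans by blast
  then show ?thesis by (simp add: algebra_simps)
qed

text \<open>The affine disc whose direction is the tangent \<open>(z\<^sub>1, - \<i> z\<^sub>2 / 2)\<close> of the leaf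
  \<open>w \<mapsto> (z\<^sub>1 exp w, z\<^sub>2 exp (- \<i> w / 2))\<close> through \<open>z\<close>.\<close>

definition leaf_disc :: "real \<Rightarrow> complex \<times> complex \<Rightarrow> complex \<Rightarrow> complex \<times> complex" where
  "leaf_disc \<rho> z \<zeta> = (fst z + \<zeta> * (fst z * \<rho>), snd z + \<zeta> * (snd z * (- \<i> / 2 * \<rho>)))"

text \<open>The function \<open>L\<close> collects the logarithm (harmonic, mean \<open>0\<close>), the increment of \<open>4 m \<bar>z\<^sub>1\<bar>\<^sup>2\<close>
  (mean \<open>4 m \<rho>\<^sup>2 \<bar>z\<^sub>1\<bar>\<^sup>2\<close>) and a lower bound for the change of the phase term. For the
  latter, let \<open>x\<close> be the change of the angle: it is the real part of a holomorphic function of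
  the disc parameter that vanishes to second order at the centre, so its mean is \<open>0\<close> and \<open>\<bar>x\<bar> \<le> 3 \<rho>\<^sup>2\<close>,
  which makes the loss at most \<open>4 m (3 \<rho>\<^sup>2)\<^sup>2\<close>.\<close>

lemma barrier_leaf_disc:
  assumes z: "fst z \<noteq> 0" "snd z \<noteq> 0" and \<rho>: "0 < \<rho>" "\<rho> \<le> 1/2" and m: "m > 0"
  shows "\<exists>L. (L has_integral 2 * pi * (4 * m * \<rho>\<^sup>2 * ((cmod (fst z))\<^sup>2 - 9 * \<rho>\<^sup>2))) {0..2*pi} \<and>
             (\<forall>t. barrier \<eta> m z + L t \<le> barrier \<eta> m (leaf_disc \<rho> z (cis t)))"
proof -
  define u where "u t = 1 * (\<rho> * cis t)" for t
  define v where "v t = - \<i> / 2 * (\<rho> * cis t)" for t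
  define x where "x t = Im (Ln (1 + u t)) - 2 * Re (Ln (1 + v t))" for t
  define p where "p = cmod (fst z)"
  define L where "L t = \<eta> * Re (Ln (1 + u t)) + 4 * m * (p\<^sup>2 * (2 * \<rho> * cos t + \<rho>\<^sup>2)) +
      4 * m * (- x t * Im (phase z) - 9 * \<rho>^4)" for t
  have nu: "cmod (u t) = \<rho>" and nv: "cmod (v t) = \<rho> / 2" for t
    using \<rho> by (simp_all add: u_def v_def norm_mult)
  have nz: "1 + u t \<noteq> 0" "1 + v t \<noteq> 0" for t
    using nu[of t] nv[of t] \<rho> by (auto simp: add_eq_0_iff norm_minus_cancel)
  have Lu: "((\<lambda>t. Ln (1 + u t)) has_integral 0) {0..2*pi}"
    unfolding u_def using \<rho> by (intro Ln_circle_mean) auto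
  have Lv: "((\<lambda>t. Ln (1 + v t)) has_integral 0) {0..2*pi}"
    unfolding v_def using \<rho> by (intro Ln_circle_mean) auto
  have x_int: "(x has_integral (0 - 2 * 0)) {0..2*pi}"
    unfolding x_def
    using has_integral_linear[OF Lu bounded_linear_Im] has_integral_linear[OF Lv bounded_linear_Re]
    by (intro has_integral_diff has_integral_mult_right) (auto simp: o_def)
  have Re_int: "((\<lambda>t. Re (Ln (1 + u t))) has_integral 0) {0..2*pi}"
    using has_integral_linear[OF Lu bounded_linear_Re] by (auto simp: o_def)
  have cos_int: "(cos has_integral (0::real)) {0..2*pi}"
  proof -
    have "(cos has_integral (sin (2*pi) - sin (0::real))) {0..2*pi}"
      by (rule fundamental_theorem_of_calculus)
         (auto simp flip: has_real_derivative_iff_has_vector_derivative intro!: derivative_eq_intros)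
    then show ?thesis by simp
  qed
  have const_int: "((\<lambda>t. c) has_integral (2 * pi * c)) {0..2*pi}" for c :: real
    using has_integral_const_real[of c 0 "2*pi"] by simp
  have "(L has_integral (\<eta> * 0 + 4 * m * (p\<^sup>2 * (2 * \<rho> * 0 + 2 * pi * \<rho>\<^sup>2)) +
      4 * m * (- (0 - 2 * 0) * Im (phase z) - 2 * pi * (9 * \<rho>^4)))) {0..2*pi}"
    unfolding L_def
    by (intro has_integral_add has_integral_diff has_integral_mult_right has_integral_mult_left
        has_integral_neg Re_int cos_int x_int const_int)
  then have L_int: "(L has_integral 2 * pi * (4 * m * \<rho>\<^sup>2 * (p\<^sup>2 - 9 * \<rho>\<^sup>2))) {0..2*pi}"
    by (simp add: algebra_simps power4_eq_xxxx power2_eq_square)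
  have "barrier \<eta> m z + L t \<le> barrier \<eta> m (leaf_disc \<rho> z (cis t))" for t
  proof -
    have disc: "leaf_disc \<rho> z (cis t) = (fst z * (1 + u t), snd z * (1 + v t))"
      by (simp add: leaf_disc_def u_def v_def algebra_simps)
    \<comment> \<open>Tangency to the leaf: the first-order terms of the two logarithms cancel.\<close>
    have "Im (u t) = 2 * Re (v t)" by (simp add: u_def v_def)
    then have "x t = Im (Ln (1 + u t) - u t) - 2 * Re (Ln (1 + v t) - v t)"
      by (simp add: x_def)
    then have "\<bar>x t\<bar> \<le> cmod (Ln (1 + u t) - u t) + 2 * cmod (Ln (1 + v t) - v t)"
      using abs_Im_le_cmod[of "Ln (1 + u t) - u t"] abs_Re_le_cmod[of "Ln (1 + v t) - v t"]
      by linarith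
    also have "cmod (Ln (1 + u t) - u t) \<le> \<rho>\<^sup>2 / (1 - \<rho>)"
      using Ln_approx_linear[of "u t"] nu \<rho> by simp
    also have "cmod (Ln (1 + v t) - v t) \<le> (\<rho> / 2)\<^sup>2 / (1 - \<rho> / 2)"
      using Ln_approx_linear[of "v t"] nv \<rho> by simp
    also have "\<rho>\<^sup>2 / (1 - \<rho>) \<le> \<rho>\<^sup>2 / (1/2)"
      using \<rho> by (intro divide_left_mono) auto
    also have "(\<rho> / 2)\<^sup>2 / (1 - \<rho> / 2) \<le> (\<rho> / 2)\<^sup>2 / (1/2)"
      using \<rho> by (intro divide_left_mono) auto
    finally have "\<bar>x t\<bar> \<le> 3 * \<rho>\<^sup>2" by (simp add: power_divide)
    then have "\<bar>x t\<bar>\<^sup>2 \<le> (3 * \<rho>\<^sup>2)\<^sup>2" by (intro power_mono) auto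
    then have x2: "(x t)\<^sup>2 \<le> 9 * \<rho>^4" by (simp add: power_mult_distrib flip: power_mult)
    have "Re (phase (leaf_disc \<rho> z (cis t))) \<ge> Re (phase z) - x t * Im (phase z) - (x t)\<^sup>2"
      unfolding disc phase_multiply[OF z nz] x_def
      by (rule Re_mult_cis_ge) (simp add: norm_phase z)
    with x2 have ph: "Re (phase (leaf_disc \<rho> z (cis t))) \<ge>
        Re (phase z) + (- x t * Im (phase z) - 9 * \<rho>^4)" by simp
    have lnp: "ln (2 * cmod (fst (leaf_disc \<rho> z (cis t)))) = ln (2 * p) + Re (Ln (1 + u t))"
      using nz[of t] z by (simp add: disc norm_mult p_def ln_mult)
    have sq: "(cmod (fst (leaf_disc \<rho> z (cis t))))\<^sup>2 = p\<^sup>2 + p\<^sup>2 * (2 * \<rho> * cos t + \<rho>\<^sup>2)"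
    proof -
      have "(cmod (1 + u t))\<^sup>2 = 1 + 2 * \<rho> * cos t + \<rho>\<^sup>2 * ((cos t)\<^sup>2 + (sin t)\<^sup>2)"
        unfolding cmod_power2 by (simp add: u_def power_mult_distrib power2_sum flip: distrib_left)
      then have "(cmod (1 + u t))\<^sup>2 = 1 + 2 * \<rho> * cos t + \<rho>\<^sup>2" by simp
      then show ?thesis
        unfolding disc fst_conv norm_mult power_mult_distrib p_def
        by (simp only: distrib_left mult_1_right add.assoc)
    qed
    have "4 * m * (Re (phase z) + (- x t * Im (phase z) - 9 * \<rho>^4)) \<le>
        4 * m * Re (phase (leaf_disc \<rho> z (cis t)))"
      using ph m by (intro mult_left_mono) auto
    then show ?thesis
      unfolding barrier_def L_def lnp sq p_def[symmetric] by (simp add: algebra_simps)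
  qed
  with L_int show ?thesis unfolding p_def by blast
qed

text \<open>At a local maximum the mean value inequality of \<open>u\<close> on a small leaf disc would
  force the mean of the barrier over the circle not to exceed its value at the centre; for
  \<open>3 \<rho> < \<bar>z\<^sub>1\<bar>\<close> it does exceed that value.\<close>

lemma no_local_max_with_barrier:
  assumes W: "open W" "z \<in> W" and psh: "psh_on W u"
    and z: "fst z \<noteq> 0" "snd z \<noteq> 0" and m: "m > 0"
    and max: "\<And>w. w \<in> W \<Longrightarrow> u w + barrier \<eta> m w \<le> u z + barrier \<eta> m z"
  shows False
proof -
  obtain e where e: "e > 0" "ball z e \<subseteq> W" using W openE by blast
  define s where "s = cmod (fst z) + cmod (snd z)"
  have s: "s > 0" using z by (simp add: s_def add_pos_nonneg)
  define \<rho> where "\<rho> = min (1/2) (min (cmod (fst z) / 4) (e / (2 * s)))"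
  have \<rho>: "\<rho> > 0" "\<rho> \<le> 1/2" "\<rho> \<le> cmod (fst z) / 4" "\<rho> \<le> e / (2 * s)"
    using z s e by (auto simp: \<rho>_def)
  have disc: "leaf_disc \<rho> z \<zeta> \<in> W" if "cmod \<zeta> \<le> 1" for \<zeta>
  proof -
    have "leaf_disc \<rho> z \<zeta> - z = (\<zeta> * (fst z * \<rho>), \<zeta> * (snd z * (- \<i> / 2 * \<rho>)))"
      by (simp add: leaf_disc_def prod_eq_iff)
    then have "norm (leaf_disc \<rho> z \<zeta> - z) \<le>
        cmod (\<zeta> * (fst z * \<rho>)) + cmod (\<zeta> * (snd z * (- \<i> / 2 * \<rho>)))"
      using norm_Pair_le by metis
    also have "\<dots> = cmod \<zeta> * (\<rho> * (cmod (fst z) + cmod (snd z) / 2))"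
      using \<rho> by (simp add: norm_mult algebra_simps)
    also have "\<dots> \<le> 1 * (\<rho> * s)"
      using that \<rho> by (intro mult_mono) (auto simp: s_def)
    also have "\<dots> \<le> 1 * (e / (2 * s) * s)"
      unfolding mult_1 using \<rho>(4) s by (intro mult_right_mono) auto
    also have "\<dots> < e" using e s by simp
    finally show ?thesis using e by (auto simp: dist_norm norm_minus_commute)
  qed
  define g where "g t = u (leaf_disc \<rho> z (cis t))" for t
  have g_int: "g absolutely_integrable_on {0..2*pi}"
    and mean: "u z \<le> 1 / (2*pi) * integral {0..2*pi} g"
    using disc psh[unfolded psh_on_def, THEN conjunct2, rule_format,
      of "fst z" "fst z * \<rho>" "snd z" "snd z * (- \<i> / 2 * \<rho>)"]
    by (simp_all add: leaf_disc_def g_def[abs_def])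
  obtain L where L: "(L has_integral 2 * pi * (4 * m * \<rho>\<^sup>2 * ((cmod (fst z))\<^sup>2 - 9 * \<rho>\<^sup>2))) {0..2*pi}"
    and bar: "\<And>t. barrier \<eta> m z + L t \<le> barrier \<eta> m (leaf_disc \<rho> z (cis t))"
    using barrier_leaf_disc[OF z \<rho>(1,2) m] by metis
  have "(3 * \<rho>)\<^sup>2 < (cmod (fst z))\<^sup>2" using \<rho> by (intro power_strict_mono) auto
  then have pos: "4 * m * \<rho>\<^sup>2 * ((cmod (fst z))\<^sup>2 - 9 * \<rho>\<^sup>2) > 0" (is "?c > 0")
    using \<rho> m by (simp add: power_mult_distrib)
  have "((\<lambda>t. u z - L t) has_integral (2 * pi * u z - 2 * pi * ?c)) {0..2*pi}"
    using has_integral_diff[OF has_integral_const_real[of "u z" 0 "2*pi"] L] by simp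
  moreover have "(g has_integral (integral {0..2*pi} g)) {0..2*pi}"
    using g_int set_lebesgue_integral_eq_integral(1) by blast
  moreover have "g t \<le> u z - L t" for t
    using max[OF disc, of "cis t"] bar[of t] by (simp add: g_def)
  ultimately have "integral {0..2*pi} g \<le> 2 * pi * u z - 2 * pi * ?c"
    using has_integral_le by blast
  also have "\<dots> = 2 * pi * (u z - ?c)" by (simp only: right_diff_distrib)
  finally have "1 / (2*pi) * integral {0..2*pi} g \<le> u z - ?c"
    by (simp add: divide_le_eq mult.commute)
  then show False using mean pos by linarith
qed

section \<open>Deck transformations and lifts from the quotient\<close>

definition shift :: "real \<Rightarrow> int \<Rightarrow> complex \<times> complex \<Rightarrow> complex \<times> complex" where
  "shift \<mu> n z = (fst z * cis (n * (2 * pi * \<mu>)), snd z * of_real (exp (n * (pi * \<mu>))))"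

lemma shift_in_M_cover: "shift \<mu> n z \<in> M_cover \<longleftrightarrow> z \<in> M_cover"
  by (cases z) (auto simp: shift_def M_cover_def)

lemma deck_shift: "deck \<mu> (shift \<mu> n z) = shift \<mu> (n + 1) z"
proof -
  have "exp (complex_of_real (2 * pi * \<mu>) * \<i>) = cis (2 * pi * \<mu>)"
    by (simp add: cis_conv_exp mult.commute)
  moreover have "cis ((real_of_int n + 1) * (2 * pi * \<mu>)) = cis (n * (2 * pi * \<mu>)) * cis (2 * pi * \<mu>)"
    by (simp add: cis_mult distrib_right)
  moreover have "exp ((real_of_int n + 1) * (pi * \<mu>)) = exp (n * (pi * \<mu>)) * exp (pi * \<mu>)"
    by (simp add: exp_add distrib_right)
  ultimately show ?thesis
    by (simp add: deck_def shift_def mult_ac)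
qed

lemma M_proj_shift:
  assumes "z \<in> M_cover"
  shows "M_proj \<mu> (shift \<mu> n z) = M_proj \<mu> z"
proof -
  have step: "M_proj \<mu> (shift \<mu> (k + 1) z) = M_proj \<mu> (shift \<mu> k z)" for k
  proof -
    have "equivclp (\<lambda>x y. x \<in> M_cover \<and> y = deck \<mu> x) (shift \<mu> k z) (shift \<mu> (k + 1) z)"
      using assms by (intro r_into_equivclp) (simp add: deck_shift shift_in_M_cover)
    then have "M_proj \<mu> (shift \<mu> k z) = M_proj \<mu> (shift \<mu> (k + 1) z)"
      using assms by (simp only: M_proj_eq_iff shift_in_M_cover)
    then show ?thesis by (rule sym)
  qed
  show ?thesis
  proof (induction n rule: int_induct[where k = 0])
    case base
    show ?case by (simp add: shift_def)
  next
    case (step1 i)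
    then show ?case using step by simp
  next
    case (step2 i)
    then show ?case using step[of "i - 1"] by simp
  qed
qed

lemma M_proj_eq_imp_shift:
  assumes "z \<in> M_cover" "w \<in> M_cover" "M_proj \<mu> z = M_proj \<mu> w"
  shows "\<exists>n. w = shift \<mu> n z"
proof -
  have e: "exp (complex_of_real x * \<i>) = cis x" for x
    by (simp add: cis_conv_exp mult.commute)
  have "\<exists>n::int. w = (exp (complex_of_real (n * (2 * pi * \<mu>)) * \<i>) * fst z,
      complex_of_real (exp (n * (pi * \<mu>))) * snd z)"
    using deck_orbit[of \<mu> z w] assms M_proj_eq_iff[of z w \<mu>] by simp
  then show ?thesis
    unfolding e shift_def by (simp only: mult.commute)
qed

lemma norm_fst_shift: "cmod (fst (shift \<mu> n z)) = cmod (fst z)"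
proof -
  have "cmod (fst z * cis x) = cmod (fst z)" for x by (simp only: norm_mult norm_cis mult_1_right)
  then show ?thesis by (simp only: shift_def fst_conv)
qed

lemma phase_shift:
  assumes "snd z \<noteq> 0"
  shows "phase (shift \<mu> n z) = phase z"
proof -
  have "ln ((cmod (snd (shift \<mu> n z)))\<^sup>2) = ln ((cmod (snd z))\<^sup>2) + n * (2 * pi * \<mu>)"
    using assms by (simp add: shift_def norm_mult power_mult_distrib ln_mult ln_realpow)
  moreover have "sgn (fst (shift \<mu> n z)) = sgn (fst z) * cis (n * (2 * pi * \<mu>))"
    by (simp add: shift_def sgn_mult)
  ultimately show ?thesis
    by (simp add: phase_def cis_mult)
qed

lemma barrier_shift: "snd z \<noteq> 0 \<Longrightarrow> barrier \<eta> m (shift \<mu> n z) = barrier \<eta> m z"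
  by (simp add: barrier_def norm_fst_shift phase_shift)

text \<open>This replaces the tube around the leaf, which is unbounded in \<open>z\<^sub>2\<close>, by a compact
  fundamental domain when a maximum is sought.\<close>

lemma shift_into_fundamental_annulus:
  assumes "\<mu> > 0" "snd z \<noteq> 0"
  shows "\<exists>n. 1 \<le> cmod (snd (shift \<mu> n z)) \<and> cmod (snd (shift \<mu> n z)) \<le> exp (pi * \<mu>)"
proof -
  define x where "x = ln (cmod (snd z)) / (pi * \<mu>)"
  define n where "n = - \<lfloor>x\<rfloor>"
  have pm: "pi * \<mu> > 0" using assms by simp
  have "cmod (snd z) = exp (x * (pi * \<mu>))" using assms pm by (simp add: x_def)
  then have "cmod (snd (shift \<mu> n z)) = exp ((x + n) * (pi * \<mu>))"
    by (simp add: shift_def norm_mult distrib_right exp_add)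
  moreover have "0 \<le> x + n" "x + n \<le> 1" unfolding n_def by linarith+
  then have "0 \<le> (x + n) * (pi * \<mu>)" "(x + n) * (pi * \<mu>) \<le> 1 * (pi * \<mu>)"
    using pm mult_nonneg_nonneg[of "x + n" "pi * \<mu>"] mult_right_mono[of "x + n" 1 "pi * \<mu>"]
    by linarith+
  ultimately show ?thesis by (intro exI[of _ n]) simp
qed

text \<open>A chart at the image of \<open>z\<close> comes from an open set that may contain only a translate of \<open>z\<close>;
  translating that set back gives one around \<open>z\<close> itself.\<close>

lemma injective_neighbourhood:
  assumes "\<mu> > 0" "z \<in> M_cover"
  shows "\<exists>V. open V \<and> z \<in> V \<and> V \<subseteq> M_cover \<and> inj_on (M_proj \<mu>) V"
proof -
  have "M_proj \<mu> z \<in> M_space \<mu>" using assms by (simp add: M_space_def M_proj_def quotientI)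
  then obtain U \<phi> where "(U, \<phi>) \<in> M_atlas \<mu>" "M_proj \<mu> z \<in> U"
    using M_atlas_covers assms by blast
  then obtain V w where V: "open V" "V \<subseteq> M_cover" "inj_on (M_proj \<mu>) V"
    and w: "w \<in> V" "M_proj \<mu> z = M_proj \<mu> w"
    by (auto simp: M_atlas_def)
  then obtain n where n: "w = shift \<mu> n z"
    using M_proj_eq_imp_shift[of z w] assms by blast
  define V' where "V' = shift \<mu> n -` V"
  have sub: "V' \<subseteq> M_cover"
    using V shift_in_M_cover unfolding V'_def by blast
  have "open V'"
    unfolding V'_def using V(1)
    by (rule continuous_open_vimage) (auto simp: shift_def[abs_def] intro!: continuous_intros)
  moreover have "inj_on (M_proj \<mu>) V'"
  proof (rule inj_onI)
    fix x y assume xy: "x \<in> V'" "y \<in> V'" "M_proj \<mu> x = M_proj \<mu> y"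
    then have "M_proj \<mu> (shift \<mu> n x) = M_proj \<mu> (shift \<mu> n y)"
      using M_proj_shift sub by (metis subsetD)
    then have "shift \<mu> n x = shift \<mu> n y"
      using xy V(3) by (auto simp: V'_def inj_on_def)
    then show "x = y" by (simp add: shift_def prod_eq_iff)
  qed
  ultimately show ?thesis using sub w n by (auto simp: V'_def)
qed

lemma psh_on_subset_cong:
  assumes psh: "psh_on D u" and sub: "W \<subseteq> D" and eq: "\<And>x. x \<in> W \<Longrightarrow> v x = u x"
  shows "psh_on W v"
  unfolding psh_on_def
proof (intro conjI allI impI)
  fix c
  have "openin (top_of_set D) {x \<in> D. u x < c}" using psh unfolding psh_on_def by blast
  then obtain T where "open T" "{x \<in> D. u x < c} = D \<inter> T" by (auto simp: openin_open)
  then have "openin (top_of_set W) (W \<inter> {x \<in> D. u x < c})"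
    using sub by (intro openin_open[THEN iffD2] exI[of _ T]) blast
  also have "W \<inter> {x \<in> D. u x < c} = {x \<in> W. v x < c}" using sub eq by auto
  finally show "openin (top_of_set W) {x \<in> W. v x < c}" .
next
  fix a1 a2 b1 b2
  assume disc: "\<forall>\<zeta>. cmod \<zeta> \<le> 1 \<longrightarrow> (a1 + \<zeta> * b1, a2 + \<zeta> * b2) \<in> W"
  have circ: "(\<lambda>t. v (a1 + cis t * b1, a2 + cis t * b2)) = (\<lambda>t. u (a1 + cis t * b1, a2 + cis t * b2))"
    by (intro ext eq disc[rule_format]) simp
  have centre: "v (a1, a2) = u (a1, a2)" using eq[OF disc[rule_format, of 0]] by simp
  have "\<forall>\<zeta>. cmod \<zeta> \<le> 1 \<longrightarrow> (a1 + \<zeta> * b1, a2 + \<zeta> * b2) \<in> D" using disc sub by blast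
  with psh[unfolded psh_on_def, THEN conjunct2, rule_format, of a1 b1 a2 b2]
  show "(\<lambda>t. v (a1 + cis t * b1, a2 + cis t * b2)) absolutely_integrable_on {0..2*pi}"
    and "v (a1, a2) \<le> 1 / (2*pi) * integral {0..2*pi} (\<lambda>t. v (a1 + cis t * b1, a2 + cis t * b2))"
    unfolding circ centre by simp_all
qed

text \<open>The charts are local inverses of the projection, so in a chart a function on the
  quotient is its own lift to the cover.\<close>

lemma psh_lift_locally:
  assumes "\<mu> > 0" and psh: "psh_on_surface (M_atlas \<mu>) (Omega \<mu>) f" and z: "z \<in> Omega_cover"
  shows "\<exists>W. open W \<and> z \<in> W \<and> W \<subseteq> Omega_cover \<and> psh_on W (\<lambda>w. f (M_proj \<mu> w))"
proof -
  have "z \<in> M_cover" using z by (auto simp: Omega_cover_def)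
  then obtain V where V: "open V" "z \<in> V" "V \<subseteq> M_cover" "inj_on (M_proj \<mu>) V"
    using injective_neighbourhood assms(1) by blast
  let ?U = "M_proj \<mu> ` V" and ?\<phi> = "inv_into V (M_proj \<mu>)"
  have "(?U, ?\<phi>) \<in> M_atlas \<mu>" using V by (auto simp: M_atlas_def)
  then have "psh_on (?\<phi> ` (?U \<inter> Omega \<mu>)) (f \<circ> inv_into ?U ?\<phi>)"
    using psh by (auto simp: psh_on_surface_def)
  moreover have "V \<inter> Omega_cover \<subseteq> ?\<phi> ` (?U \<inter> Omega \<mu>)"
  proof
    fix w assume w: "w \<in> V \<inter> Omega_cover"
    then have "?\<phi> (M_proj \<mu> w) = w" using V by simp
    then show "w \<in> ?\<phi> ` (?U \<inter> Omega \<mu>)"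
      using w by (metis IntD1 IntD2 IntI Omega_def imageI)
  qed
  moreover have "f (M_proj \<mu> w) = (f \<circ> inv_into ?U ?\<phi>) w" if "w \<in> V \<inter> Omega_cover" for w
  proof -
    have "inv_into ?U ?\<phi> w = M_proj \<mu> w"
      using that V by (intro inv_into_f_eq) (auto intro: inj_on_inv_into)
    then show ?thesis by simp
  qed
  ultimately have "psh_on (V \<inter> Omega_cover) (\<lambda>w. f (M_proj \<mu> w))"
    by (rule psh_on_subset_cong)
  then show ?thesis
    using V z open_Omega_cover by (intro exI[of _ "V \<inter> Omega_cover"]) auto
qed

section \<open>A negative bound up to the puncture\<close>

text \<open>A compact piece, modulo deck transformations, of the tube \<open>cos a \<ge> 1/2\<close> around the
  leaf \<open>a = 0\<close>. The tube lies in \<open>\<Omega>\<close> for \<open>\<bar>z\<^sub>1\<bar> \<le> 1/2\<close>, because \<open>\<Omega>\<close> is given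
  by \<open>0 < \<bar>z\<^sub>1\<bar> < 2 cos a\<close>.\<close>

definition collar :: "real \<Rightarrow> real \<Rightarrow> (complex \<times> complex) set" where
  "collar \<mu> \<delta> = {z. \<delta> \<le> cmod (fst z) \<and> cmod (fst z) \<le> 1/2 \<and>
      1 \<le> cmod (snd z) \<and> cmod (snd z) \<le> exp (pi * \<mu>) \<and> 1/2 \<le> Re (phase z)}"

lemma compact_collar:
  assumes "\<delta> > 0"
  shows "compact (collar \<mu> \<delta>)"
proof -
  define B where "B = (cball 0 (1/2) - ball (0::complex) \<delta>) \<times> (cball 0 (exp (pi * \<mu>)) - ball (0::complex) 1)"
  have B: "compact B"
    unfolding B_def by (rule compact_Times; rule compact_diff) auto
  have sub: "B \<subseteq> (- {0}) \<times> (- {0})" using assms by (auto simp: B_def)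
  have cont: "continuous_on B (\<lambda>z. Re (phase z))"
    by (rule continuous_on_Re[OF continuous_on_subset[OF continuous_on_phase sub]])
  have "closed (B \<inter> (\<lambda>z. Re (phase z)) -` {1/2..})"
    by (rule continuous_closed_preimage[OF cont compact_imp_closed[OF B] closed_atLeast])
  from compact_Int_closed[OF B this] have "compact (B \<inter> (\<lambda>z. Re (phase z)) -` {1/2..})"
    by (simp only: Int_assoc[symmetric] Int_absorb)
  moreover have "B \<inter> (\<lambda>z. Re (phase z)) -` {1/2..} = collar \<mu> \<delta>"
    by (auto simp: B_def collar_def)
  ultimately show ?thesis by simp
qed

text \<open>The constant \<open>- 2 m\<close> is the maximum of the lift \<open>u\<close> on the outer face \<open>\<bar>z\<^sub>1\<bar> = 1/2\<close> of the tube.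
  For fixed \<open>\<eta>\<close> the sum of \<open>u\<close> and the barrier is at most \<open>- m\<close> on every face of a collar that
  reaches close enough to the puncture: on the outer face by the choice of \<open>m\<close>, on the sides
  \<open>cos a = 1/2\<close> because the phase term is \<open>- 2 m\<close> there, on the inner face
  by the logarithm; the quadratic term adds at most \<open>m\<close>. A larger value would give a maximum
  off these faces, and a boundary point of the collar with respect to \<open>\<bar>z\<^sub>2\<bar>\<close> is no obstacle since
  everything is invariant under the deck transformation.\<close>

lemma negative_psh_bounded_away_from_0:
  assumes \<mu>: "\<mu> > 0" and psh: "psh_on_surface (M_atlas \<mu>) (Omega \<mu>) f"
    and neg: "\<And>p. p \<in> Omega \<mu> \<Longrightarrow> f p < 0"
  shows "\<exists>m>0. \<forall>r\<in>{0<..1/2}. f (M_proj \<mu> (- of_real r, 1)) \<le> - m"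
proof -
  define u where "u z = f (M_proj \<mu> z)" for z
  have u_neg: "u z < 0" if "z \<in> Omega_cover" for z
    using that neg by (auto simp: u_def Omega_def)
  have u_shift: "u (shift \<mu> n z) = u z" if "snd z \<noteq> 0" for n z
    using that by (cases z) (simp add: u_def M_proj_shift M_cover_def)
  have in_Omega: "z \<in> Omega_cover" if "fst z \<noteq> 0" "snd z \<noteq> 0" "cmod (fst z) \<le> 1/2" "1/2 \<le> Re (phase z)" for z
    using that by (auto simp: Omega_cover_iff_phase)
  have collar_D: "z \<in> Omega_cover" "fst z \<noteq> 0" "snd z \<noteq> 0" if "z \<in> collar \<mu> \<delta>" "\<delta> > 0" for z \<delta>
    using that by (auto simp: collar_def intro!: in_Omega)
  have usc: "eventually (\<lambda>y. u y < c) (nhds z)" if "z \<in> Omega_cover" "u z < c" for z c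
  proof -
    obtain W where W: "open W" "z \<in> W" "psh_on W u"
      using psh_lift_locally[OF \<mu> psh \<open>z \<in> Omega_cover\<close>] unfolding u_def by blast
    then have "open {x \<in> W. u x < c}"
      using openin_open_trans[of W "{x \<in> W. u x < c}"] by (simp add: psh_on_def)
    then show ?thesis using W that unfolding eventually_nhds by blast
  qed
  have base: "(- of_real r, 1) \<in> collar \<mu> \<delta>" "phase (- of_real r, 1) = 1"
    if "0 < r" "\<delta> \<le> r" "r \<le> 1/2" for r \<delta>
  proof -
    show "phase (- of_real r, 1) = 1" using that by (simp add: phase_def sgn_eq)
    then show "(- of_real r, 1) \<in> collar \<mu> \<delta>" using that \<mu> by (simp add: collar_def)
  qed
  have "collar \<mu> (1/2) \<noteq> {}" using base(1)[of "1/2" "1/2"] by auto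
  then obtain z0 where z0: "z0 \<in> collar \<mu> (1/2)" "\<And>z. z \<in> collar \<mu> (1/2) \<Longrightarrow> u z \<le> u z0"
    using upper_semicontinuous_attains_max[of "collar \<mu> (1/2)" u] compact_collar[of "1/2" \<mu>]
      usc collar_D by (metis half_gt_zero zero_less_one)
  define m where "m = - u z0 / 2"
  have m: "m > 0" using u_neg[OF collar_D(1)[OF z0(1)]] by (simp add: m_def)
  have face: "u z \<le> - 2 * m" if "z \<in> collar \<mu> (1/2)" for z
    using z0(2)[OF that] by (simp add: m_def)
  have bound: "u (- of_real r, 1) + \<eta> * ln (2 * r) \<le> - m" if r: "0 < r" "r \<le> 1/2" and \<eta>: "\<eta> > 0" for r \<eta>
  proof (rule ccontr)
    assume contra: "\<not> ?thesis"
    define g where "g z = u z + barrier \<eta> m z" for z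
    have "barrier \<eta> m (- of_real r, 1) = \<eta> * ln (2 * r) + 4 * m * r\<^sup>2"
      using base(2)[of r r] r by (simp add: barrier_def)
    moreover have "4 * m * r\<^sup>2 \<ge> 0" using m by simp
    ultimately have big: "g (- of_real r, 1) > - m"
      using contra unfolding g_def by linarith
    \<comment> \<open>The inner radius is so small that the logarithmic term is at most \<open>- 2 m\<close> there.\<close>
    define \<delta> where "\<delta> = min r (exp (- 2 * m / \<eta>) / 2)"
    have \<delta>: "\<delta> > 0" "\<delta> \<le> r" using r by (auto simp: \<delta>_def)
    have "ln (2 * \<delta>) \<le> ln (exp (- 2 * m / \<eta>))"
      using \<delta>(1) by (subst ln_le_cancel_iff) (auto simp: \<delta>_def)
    then have ln_\<delta>: "\<eta> * ln (2 * \<delta>) \<le> - 2 * m"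
      using \<eta> by (simp add: field_simps)
    have g_usc: "eventually (\<lambda>y. g y < c) (nhds z)" if z: "z \<in> collar \<mu> \<delta>" and c: "g z < c" for z c
    proof -
      define d where "d = (c - g z) / 2"
      have "d > 0" using c by (simp add: d_def)
      have "eventually (\<lambda>y. u y < u z + d) (nhds z)"
        using usc collar_D z \<delta> \<open>d > 0\<close> by simp
      moreover have "isCont (barrier \<eta> m) z"
        using collar_D(2,3)[OF z \<delta>(1)]
        by (intro continuous_on_interior[OF continuous_on_barrier])
           (simp add: interior_open open_Times open_Compl mem_Times_iff)
      then have "eventually (\<lambda>y. barrier \<eta> m y < barrier \<eta> m z + d) (nhds z)"
        using \<open>d > 0\<close> by (intro order_tendstoD(2)) (auto simp: isCont_def tendsto_at_iff_tendsto_nhds)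
      ultimately show ?thesis
        by eventually_elim (simp add: g_def d_def field_simps)
    qed
    have K: "(- of_real r, 1) \<in> collar \<mu> \<delta>" using base(1) r \<delta> by blast
    then obtain z where z: "z \<in> collar \<mu> \<delta>" "\<And>y. y \<in> collar \<mu> \<delta> \<Longrightarrow> g y \<le> g z"
      using upper_semicontinuous_attains_max[of "collar \<mu> \<delta>" g] compact_collar[OF \<delta>(1)] g_usc by blast
    have gz: "g z > - m" using z(2)[OF K] big by linarith
    note zD = collar_D[OF z(1) \<delta>(1)]
    define s where "s = cmod (fst z)"
    have s: "\<delta> \<le> s" "s \<le> 1/2" "Re (phase z) \<ge> 1/2" and s0: "s > 0"
      using z(1) \<delta> by (auto simp: collar_def s_def)
    have ph1: "Re (phase z) \<le> 1" using norm_phase[OF zD(2)] complex_Re_le_cmod[of "phase z"] by simp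
    have uz: "u z < 0" using u_neg zD by blast
    have gz_eq: "g z = u z + \<eta> * ln (2 * s) + 4 * m * s\<^sup>2 - 4 * m * (1 - Re (phase z))"
      by (simp add: g_def barrier_def s_def)
    have ln_le: "\<eta> * ln (2 * s) \<le> 0" using s s0 \<eta> by (simp add: mult_nonneg_nonpos)
    have "s\<^sup>2 \<le> (1/2)\<^sup>2" using s s0 by (intro power_mono) auto
    then have sq_le: "4 * m * s\<^sup>2 \<le> m" using m by (simp add: power_divide)
    have ph_le: "4 * m * (1 - Re (phase z)) \<ge> 0" using m ph1 by simp
    have "s \<noteq> \<delta>" using gz gz_eq uz sq_le ph_le ln_\<delta> by auto
    moreover have "s \<noteq> 1/2"
    proof
      assume "s = 1/2"
      then have "u z \<le> - 2 * m" using z(1) by (intro face) (auto simp: collar_def s_def)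
      then show False using gz gz_eq ln_le sq_le ph_le by linarith
    qed
    moreover have "Re (phase z) \<noteq> 1/2"
    proof
      assume "Re (phase z) = 1/2"
      then have "4 * m * (1 - Re (phase z)) = 2 * m" by simp
      then show False using gz gz_eq uz ln_le sq_le by linarith
    qed
    ultimately have strict: "\<delta> < s" "s < 1/2" "1/2 < Re (phase z)" using s by auto
    \<comment> \<open>The open tube without a restriction on \<open>z\<^sub>2\<close>: each of its points has a translate in the
      collar, so the maximum over the collar is a maximum over the tube.\<close>
    define T where "T = {y \<in> (- {0}) \<times> (- {0}). \<delta> < cmod (fst y) \<and> cmod (fst y) < 1/2 \<and> 1/2 < Re (phase y)}"
    have T: "open T"
    proof -
      let ?D = "(- {0::complex}) \<times> (- {0::complex})"
      have D: "open ?D" by (intro open_Times) auto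
      have "continuous_on ?D (\<lambda>y. (cmod (fst y), Re (phase y)))"
        by (intro continuous_intros continuous_on_phase)
      then have "open (?D \<inter> (\<lambda>y. (cmod (fst y), Re (phase y))) -` ({\<delta><..<1/2} \<times> {1/2<..}))"
        using D by (intro continuous_open_preimage open_Times) auto
      also have "?D \<inter> (\<lambda>y. (cmod (fst y), Re (phase y))) -` ({\<delta><..<1/2} \<times> {1/2<..}) = T"
        by (auto simp: T_def)
      finally show ?thesis .
    qed
    obtain W where W: "open W" "z \<in> W" "psh_on W u"
      using psh_lift_locally[OF \<mu> psh zD(1)] unfolding u_def by blast
    have "u y + barrier \<eta> m y \<le> u z + barrier \<eta> m z" if "y \<in> W \<inter> T" for y
    proof -
      have y: "y \<in> T" "snd y \<noteq> 0" using that by (auto simp: T_def)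
      obtain n where "1 \<le> cmod (snd (shift \<mu> n y))" "cmod (snd (shift \<mu> n y)) \<le> exp (pi * \<mu>)"
        using shift_into_fundamental_annulus[OF \<mu> y(2)] by blast
      then have "shift \<mu> n y \<in> collar \<mu> \<delta>"
        using y by (auto simp: collar_def T_def norm_fst_shift phase_shift)
      from z(2)[OF this] show ?thesis
        using y by (simp add: g_def u_shift barrier_shift)
    qed
    moreover have "z \<in> W \<inter> T" using W zD strict by (simp add: T_def s_def mem_Times_iff)
    moreover have "psh_on (W \<inter> T) u" by (rule psh_on_subset_cong[OF W(3)]) auto
    ultimately show False
      using no_local_max_with_barrier[of "W \<inter> T" z u m \<eta>] W(1) T zD m by blast
  qed
  have "u (- of_real r, 1) \<le> - m" if r: "0 < r" "r \<le> 1/2" for r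
  proof (rule field_le_epsilon)
    fix e :: real assume e: "e > 0"
    define l where "l = - ln (2 * r)"
    have l: "l \<ge> 0" using r by (simp add: l_def)
    have "u (- of_real r, 1) \<le> - m + e / (l + 1) * l"
      using bound[OF r, of "e / (l + 1)"] e l by (simp add: l_def)
    also have "e / (l + 1) * l \<le> e" using e l by (simp add: field_simps)
    finally show "u (- of_real r, 1) \<le> - m + e" by simp
  qed
  then show ?thesis using m unfolding u_def by auto
qed

theorem corollary2p8:
  fixes \<mu> :: real
  assumes "\<mu> > 1"
  shows "\<not> hyperconvex (M_top \<mu>) (M_atlas \<mu>) (Omega \<mu>)"
proof
  assume "hyperconvex (M_top \<mu>) (M_atlas \<mu>) (Omega \<mu>)"
  then obtain f where neg: "\<And>p. p \<in> Omega \<mu> \<Longrightarrow> f p < 0"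
    and psh: "psh_on_surface (M_atlas \<mu>) (Omega \<mu>) f"
    and exh: "\<And>c. c < 0 \<Longrightarrow> relatively_compactin (subtopology (M_top \<mu>) (Omega \<mu>)) {p \<in> Omega \<mu>. f p < c}"
    unfolding hyperconvex_def by blast
  have \<mu>: "\<mu> > 0" using assms by simp
  obtain m where m: "m > 0" "\<And>r. 0 < r \<Longrightarrow> r \<le> 1/2 \<Longrightarrow> f (M_proj \<mu> (- of_real r, 1)) \<le> - m"
    using negative_psh_bounded_away_from_0[OF \<mu> psh neg] by auto
  define S where "S = {p \<in> Omega \<mu>. f p < - m / 2}"
  define C where "C = subtopology (M_top \<mu>) (Omega \<mu>) closure_of S"
  have "relatively_compactin (subtopology (M_top \<mu>) (Omega \<mu>)) S"
    unfolding S_def using exh[of "- m / 2"] m by simp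
  then have C: "compactin (M_top \<mu>) C" "C \<subseteq> Omega \<mu>" "S \<subseteq> C"
    unfolding relatively_compactin_def C_def
    by (auto simp: compactin_subtopology closure_of_subset)
  \<comment> \<open>The modulus of the first coordinate descends to the quotient, and it is positive on \<open>\<Omega>\<^sub>\<mu>\<close>.\<close>
  obtain h where h: "continuous_map (M_top \<mu>) euclideanreal h"
    "\<And>z. z \<in> M_cover \<Longrightarrow> h (M_proj \<mu> z) = cmod (fst z)"
  proof (rule quotient_map_lift_exists[OF quotient_map_M_proj, of euclideanreal "\<lambda>z. cmod (fst z)" \<mu>])
    show "continuous_map (top_of_set M_cover) euclideanreal (\<lambda>z. cmod (fst z))"
      by (auto intro!: continuous_intros)
    show "cmod (fst x) = cmod (fst y)"
      if "x \<in> topspace (top_of_set M_cover)" "y \<in> topspace (top_of_set M_cover)"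
        "M_proj \<mu> x = M_proj \<mu> y" for x y
      using M_proj_eq_imp_shift[of x y \<mu>] that by (auto simp: norm_fst_shift)
  qed (use that in auto)
  have "{0<..1/2} \<subseteq> h ` C"
  proof
    fix r :: real assume r: "r \<in> {0<..1/2}"
    let ?z = "(- complex_of_real r, 1 :: complex)"
    have "phase ?z = 1" using r by (simp add: phase_def sgn_eq)
    then have "?z \<in> Omega_cover" using r by (simp add: Omega_cover_iff_phase)
    then have "M_proj \<mu> ?z \<in> S" using m r by (force simp: S_def Omega_def)
    moreover have "h (M_proj \<mu> ?z) = r" using r h(2)[of ?z] by (simp add: M_cover_def)
    ultimately show "r \<in> h ` C" using C by force
  qed
  moreover have "closed (h ` C)"
    using image_compactin[OF C(1) h(1)] by (simp add: compact_imp_closed)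
  ultimately have "closure {0<..1/2} \<subseteq> h ` C" by (rule closure_minimal)
  moreover have "(0::real) \<in> closure {0<..1/2}" by (subst closure_greaterThanAtMost) auto
  ultimately have "0 \<in> h ` C" by (rule subsetD)
  then obtain p where p: "p \<in> C" "h p = 0" by auto
  then obtain z where z: "z \<in> Omega_cover" "p = M_proj \<mu> z"
    using C by (auto simp: Omega_def)
  then have zc: "z \<in> M_cover" by (auto simp: Omega_cover_def)
  then have "fst z = 0" using h(2) p z by simp
  moreover have "snd z \<noteq> 0" using zc by (auto simp: M_cover_def)
  ultimately show False using z Omega_cover_iff_phase by blast
qed

end
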